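(* Let $d=3$. There exists a Borel function $V\le 0$ on $\mathbb{R}^3$ such that (a) $V\in\mathcal K_3$ and (b) $\|S(V,t)\|_\infty=\infty$ for every $t>0$.
   Context: $g(t,x,y)=(4\pi t)^{-d/2}e^{-|y-x|^2/(4t)}$. For Borel $V$, $S(V,t,x,y)=\int_0^t\int_{\mathbb{R}^d}\frac{g(s,x,z)g(t-s,z,y)}{g(t,x,y)}|V(z)|\,dz\,ds$ and $\|S(V,t)\|_\infty=\sup_{x,y}S(V,t,x,y)$. $V\in\mathcal K_d$ (Kato class) means $\lim_{t\to0^+}\sup_{x\in\mathbb{R}^d}\int_0^t\int_{\mathbb{R}^d}g(s,x,z)|V(z)|\,dz\,ds=0$. *)

theory Defs
  imports "HOL-Analysis.Analysis"
begin

definition heat_kernel :: "real \<Rightarrow> 'a::euclidean_space \<Rightarrow> 'a \<Rightarrow> real" where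
  "heat_kernel t x y =
     (4 * pi * t) powr (- real DIM('a) / 2) * exp (- (norm (y - x))\<^sup>2 / (4 * t))"

definition S_fun :: "('a::euclidean_space \<Rightarrow> real) \<Rightarrow> real \<Rightarrow> 'a \<Rightarrow> 'a \<Rightarrow> ennreal" where
  "S_fun V t x y =
     (\<integral>\<^sup>+ s \<in> {0<..<t}. (\<integral>\<^sup>+ z. ennreal
        (heat_kernel s x z * heat_kernel (t - s) z y / heat_kernel t x y * \<bar>V z\<bar>) \<partial>lborel) \<partial>lborel)"

definition S_norm :: "('a::euclidean_space \<Rightarrow> real) \<Rightarrow> real \<Rightarrow> ennreal" where
  "S_norm V t = (SUP xy \<in> UNIV. S_fun V t (fst xy) (snd xy))"

definition kato_class :: "('a::euclidean_space \<Rightarrow> real) \<Rightarrow> bool" where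
  "kato_class V \<longleftrightarrow>
     ((\<lambda>t::real. SUP x \<in> UNIV. (\<integral>\<^sup>+ s \<in> {0<..<t}. (\<integral>\<^sup>+ z. ennreal
         (heat_kernel s x z * \<bar>V z\<bar>) \<partial>lborel) \<partial>lborel)) \<longlongrightarrow> 0) (at_right 0)"

end

theory Submission
  imports Defs "HOL-Probability.Distributions"
begin

text \<open>
  The kernel of \<open>S(V, t, 0, y)\<close> is a Gaussian with mean \<open>(s/t) y\<close> and variance of order \<open>s\<close>. For
  \<open>y = t v e\<^sub>1\<close> with a huge speed \<open>v\<close>, the bridge spends the time interval \<open>[4\<^sup>-\<^sup>k, 2 4\<^sup>-\<^sup>k]\<close> in a box
  of length about \<open>v 4\<^sup>-\<^sup>k\<close> and width about \<open>2\<^sup>-\<^sup>k\<close>. Give this box the height \<open>4\<^sup>k c\<^sub>k\<close> with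
  \<open>c\<^sub>k = \<delta> / (12 (k + 1))\<close>. Then the box contributes a multiple of \<open>c\<^sub>k\<close> to \<open>S\<close>, and these contributions
  sum to an arbitrarily large number. For Brownian motion without drift the box looks like a
  two-dimensional disc of radius \<open>2\<^sup>-\<^sup>k\<close>, so it contributes at most \<open>c\<^sub>k (1 + O(k)) = O(\<delta>)\<close> to the Kato
  integral; since \<open>v\<close> is huge, the boxes are so far apart that only one of them matters near any given
  point. Summing such potentials with \<open>\<delta> = 2\<^sup>-\<^sup>n\<close> and boxes with larger and larger \<open>k\<close> gives \<open>V\<close>.
\<close>

section \<open>The heat kernel and one-dimensional Gaussian integrals\<close>

lemma heat_kernel_nonneg [simp]: "0 \<le> heat_kernel t x y"
  by (simp add: heat_kernel_def)

lemma heat_kernel_pos: "0 < t \<Longrightarrow> 0 < heat_kernel t x y"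
  by (simp add: heat_kernel_def)

lemma measurable_heat_kernel [measurable (raw)]:
  assumes [measurable]: "f \<in> borel_measurable M" "g \<in> borel_measurable M" "h \<in> borel_measurable M"
  shows "(\<lambda>w. heat_kernel (f w) (g w) (h w)) \<in> borel_measurable M"
  unfolding heat_kernel_def by measurable

lemma nn_integral_normal_density:
  "0 < \<sigma> \<Longrightarrow> (\<integral>\<^sup>+u. ennreal (normal_density \<mu> \<sigma> u) \<partial>lborel) = 1"
  by (simp add: nn_integral_eq_integral)

lemma nn_integral_normal_density_le_1:
  "0 < \<sigma> \<Longrightarrow> (\<integral>\<^sup>+u. ennreal (normal_density \<mu> \<sigma> u) * indicator A u \<partial>lborel) \<le> 1"
  by (subst nn_integral_normal_density[of \<sigma> \<mu>, symmetric])
     (auto intro!: nn_integral_mono simp: indicator_def)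

text \<open>The density never exceeds its peak \<open>1 / sqrt (4 * pi * s)\<close>. The deviation
  \<open>sqrt (2 * s)\<close> is that of one coordinate under \<open>heat_kernel s\<close>.\<close>

lemma nn_integral_normal_density_Icc_le:
  assumes "0 < s" "a \<le> b"
  shows "(\<integral>\<^sup>+u. ennreal (normal_density \<mu> (sqrt (2 * s)) u) * indicator {a..b} u \<partial>lborel)
           \<le> ennreal ((b - a) / sqrt (4 * pi * s))"
proof -
  have "normal_density \<mu> (sqrt (2 * s)) u \<le> 1 / sqrt (4 * pi * s)" for u
  proof -
    have "exp (- (u - \<mu>)\<^sup>2 / (2 * (sqrt (2 * s))\<^sup>2)) \<le> 1"
      using assms by simp
    then show ?thesis
      using assms by (simp add: normal_density_def divide_simps algebra_simps)
  qed
  then have "(\<integral>\<^sup>+u. ennreal (normal_density \<mu> (sqrt (2 * s)) u) * indicator {a..b} u \<partial>lborel)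
      \<le> (\<integral>\<^sup>+u. ennreal (1 / sqrt (4 * pi * s)) * indicator {a..b} u \<partial>lborel)"
    by (intro nn_integral_mono mult_right_mono) (auto simp: ennreal_leI)
  also have "\<dots> = ennreal ((b - a) / sqrt (4 * pi * s))"
    using assms by (simp add: nn_integral_cmult_indicator ennreal_mult[symmetric])
  finally show ?thesis .
qed

text \<open>Within \<open>sqrt s\<close> of the mean the exponent is at least -1/4, and this
  interval has length \<open>2 * sqrt s\<close>. The bound depends on neither \<open>s\<close> nor
  \<open>\<mu>\<close>.\<close>

lemma nn_integral_normal_density_Icc_ge:
  assumes "0 < s" "a \<le> \<mu> - sqrt s" "\<mu> + sqrt s \<le> b"
  shows "ennreal (exp (-1/4) / sqrt pi)
           \<le> (\<integral>\<^sup>+u. ennreal (normal_density \<mu> (sqrt (2 * s)) u) * indicator {a..b} u \<partial>lborel)"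
proof -
  have dens: "exp (-1/4) / sqrt (4 * pi * s) \<le> normal_density \<mu> (sqrt (2 * s)) u"
    if "u \<in> {\<mu> - sqrt s..\<mu> + sqrt s}" for u
  proof -
    have "\<bar>u - \<mu>\<bar> \<le> sqrt s"
      using that by auto
    then have "(u - \<mu>)\<^sup>2 \<le> s"
      using assms by (simp add: real_le_rsqrt sqrt_ge_absD)
    then have "exp (-1/4) \<le> exp (- (u - \<mu>)\<^sup>2 / (2 * (sqrt (2 * s))\<^sup>2))"
      using assms by (simp add: divide_simps)
    from divide_right_mono[OF this, of "sqrt (4 * pi * s)"] show ?thesis
      using assms by (simp add: normal_density_def mult_ac)
  qed
  have "sqrt (4 * pi * s) = 2 * sqrt pi * sqrt s"
    by (simp add: real_sqrt_mult)
  then have "ennreal (exp (-1/4) / sqrt pi) = ennreal (exp (-1/4) / sqrt (4 * pi * s) * (2 * sqrt s))"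
    using assms by simp
  also have "\<dots> = (\<integral>\<^sup>+u. ennreal (exp (-1/4) / sqrt (4 * pi * s))
        * indicator {\<mu> - sqrt s..\<mu> + sqrt s} u \<partial>lborel)"
    using assms by (simp add: nn_integral_cmult_indicator ennreal_mult[symmetric] flip: mult_2)
  also have "\<dots> \<le> (\<integral>\<^sup>+u. ennreal (normal_density \<mu> (sqrt (2 * s)) u) * indicator {a..b} u \<partial>lborel)"
    using assms dens by (intro nn_integral_mono) (auto simp: indicator_def ennreal_leI)
  finally show ?thesis .
qed

text \<open>Half of the exponent is spent on the decay, using \<open>s \<le> 1\<close>. The other
  half is a Gaussian of doubled variance and mass 1; its normalisation costs \<open>sqrt 2\<close>,
  rounded up to 2.\<close>

lemma nn_integral_normal_density_tail_le:
  assumes "0 < s" "s \<le> 1" "0 \<le> D" "\<And>u. u \<in> A \<Longrightarrow> D \<le> \<bar>u - \<mu>\<bar>"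
  shows "(\<integral>\<^sup>+u. ennreal (normal_density \<mu> (sqrt (2 * s)) u) * indicator A u \<partial>lborel)
           \<le> ennreal (2 * exp (- D\<^sup>2 / 8))"
proof -
  have dens: "normal_density \<mu> (sqrt (2 * s)) u
      \<le> 2 * exp (- D\<^sup>2 / 8) * normal_density \<mu> (sqrt (2 * (2 * s))) u" if "u \<in> A" for u
  proof -
    have "D\<^sup>2 \<le> (u - \<mu>)\<^sup>2"
      using assms that by (metis abs_le_square_iff abs_of_nonneg)
    moreover have "s * D\<^sup>2 \<le> D\<^sup>2"
      using assms by (simp add: mult_left_le_one_le)
    ultimately have "- (u - \<mu>)\<^sup>2 / (4 * s) \<le> - D\<^sup>2 / 8 + - (u - \<mu>)\<^sup>2 / (8 * s)"
      using assms by (simp add: field_simps)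
    then have *: "exp (- (u - \<mu>)\<^sup>2 / (4 * s)) \<le> exp (- D\<^sup>2 / 8) * exp (- (u - \<mu>)\<^sup>2 / (8 * s))"
      by (simp flip: exp_add)
    have "sqrt 2 \<le> 2"
      by (simp add: real_le_lsqrt)
    have "sqrt (8 * pi * s) = sqrt 2 * sqrt (4 * pi * s)"
      by (simp flip: real_sqrt_mult)
    then have "1 / sqrt (4 * pi * s) = sqrt 2 * (1 / sqrt (8 * pi * s))"
      by simp
    also have "\<dots> \<le> 2 * (1 / sqrt (8 * pi * s))"
      using \<open>sqrt 2 \<le> 2\<close> assms by (intro mult_right_mono) auto
    finally have "1 / sqrt (4 * pi * s) \<le> 2 * (1 / sqrt (8 * pi * s))" .
    from mult_mono[OF this *] show ?thesis
      using assms by (simp add: normal_density_def mult_ac)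
  qed
  then have "(\<integral>\<^sup>+u. ennreal (normal_density \<mu> (sqrt (2 * s)) u) * indicator A u \<partial>lborel)
      \<le> (\<integral>\<^sup>+u. ennreal (2 * exp (- D\<^sup>2 / 8)) * ennreal (normal_density \<mu> (sqrt (2 * (2 * s))) u) \<partial>lborel)"
    by (intro nn_integral_mono) (auto simp: indicator_def ennreal_leI simp flip: ennreal_mult)
  also have "\<dots> = ennreal (2 * exp (- D\<^sup>2 / 8))"
    using assms by (simp add: nn_integral_cmult nn_integral_normal_density)
  finally show ?thesis .
qed

section \<open>Product form of the heat kernel and the Brownian bridge\<close>

lemma heat_kernel_eq_prod:
  fixes x z :: "'a::euclidean_space"
  assumes "0 < s"
  shows "heat_kernel s x z = (\<Prod>b\<in>Basis. normal_density (x \<bullet> b) (sqrt (2 * s)) (z \<bullet> b))"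
proof -
  have "(\<Prod>b\<in>(Basis::'a set). 1 / sqrt (2 * pi * (sqrt (2 * s))\<^sup>2)) = (4 * pi * s) powr (- real DIM('a) / 2)"
    using assms by (simp add: powr_half_sqrt[symmetric] powr_powr powr_divide powr_minus_divide
        powr_realpow[symmetric] mult_ac)
  moreover have "(\<Prod>b\<in>Basis. exp (- (z \<bullet> b - x \<bullet> b)\<^sup>2 / (2 * (sqrt (2 * s))\<^sup>2)))
      = exp (- (norm (z - x))\<^sup>2 / (4 * s))"
    using assms unfolding power2_norm_eq_inner euclidean_inner[of "z - x" "z - x"]
    by (simp add: inner_diff_left power2_eq_square exp_sum[symmetric] sum_divide_distrib sum_negf)
  ultimately show ?thesis
    unfolding heat_kernel_def normal_density_def prod.distrib by (simp only:)
qed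

text \<open>Completing the square in \<open>z\<close> turns the three exponents into one. The result
  is the law at time \<open>s\<close> of the Brownian bridge from \<open>x\<close> to
  \<open>y\<close>.\<close>

lemma heat_kernel_bridge:
  fixes x y z :: "'a::euclidean_space"
  assumes "0 < s" "s < t"
  shows "heat_kernel s x z * heat_kernel (t - s) z y / heat_kernel t x y
    = heat_kernel (s * (t - s) / t) (x + (s / t) *\<^sub>R (y - x)) z"
proof -
  define p where "p = - real DIM('a) / 2"
  have "(4 * pi * s) powr p * (4 * pi * (t - s)) powr p / (4 * pi * t) powr p
      = (4 * pi * (s * (t - s) / t)) powr p"
    using assms by (simp flip: powr_mult powr_divide) (simp add: field_simps)
  moreover define a b where "a = z - x" and "b = y - x"
  have "- (norm a)\<^sup>2 / (4 * s) + - (norm (b - a))\<^sup>2 / (4 * (t - s)) - - (norm b)\<^sup>2 / (4 * t)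
      = - (norm (a - (s / t) *\<^sub>R b))\<^sup>2 / (4 * (s * (t - s) / t))"
  proof -
    \<comment> \<open>In terms of these three inner products the claim is a rational
      identity.\<close>
    define A B C where "A = a \<bullet> a" and "B = b \<bullet> b" and "C = a \<bullet> b"
    have n: "(norm a)\<^sup>2 = A" "(norm b)\<^sup>2 = B" "(norm (b - a))\<^sup>2 = A + B - 2 * C"
      "(norm (a - (s / t) *\<^sub>R b))\<^sup>2 = A - 2 * (s / t) * C + (s / t)\<^sup>2 * B"
      unfolding power2_norm_eq_inner A_def B_def C_def
      by (simp_all add: inner_diff_left inner_diff_right inner_commute power2_eq_square)
    have "t - s \<noteq> 0" "s \<noteq> 0" "t \<noteq> 0"
      using assms by auto
    then show ?thesis
      unfolding n by (simp add: divide_simps power2_eq_square) (simp add: algebra_simps)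
  qed
  then have "exp (- (norm a)\<^sup>2 / (4 * s)) * exp (- (norm (b - a))\<^sup>2 / (4 * (t - s))) / exp (- (norm b)\<^sup>2 / (4 * t))
      = exp (- (norm (a - (s / t) *\<^sub>R b))\<^sup>2 / (4 * (s * (t - s) / t)))"
    by (simp only: exp_add[symmetric] exp_diff[symmetric])
  moreover have "b - a = y - z" "a - (s / t) *\<^sub>R b = z - (x + (s / t) *\<^sub>R (y - x))"
    by (simp_all add: a_def b_def)
  moreover have "(P * E) * (P' * E') / (P'' * E'') = (P * P' / P'') * (E * E' / E'')"
    for P P' P'' E E' E'' :: real
    by simp
  ultimately show ?thesis
    unfolding heat_kernel_def p_def[symmetric] a_def[symmetric] b_def[symmetric] by (simp only:)
qed

lemma nn_integral_heat_kernel: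
  fixes x :: "'a::euclidean_space"
  assumes "0 < s"
  shows "(\<integral>\<^sup>+z. ennreal (heat_kernel s x z) \<partial>lborel) = 1"
  using assms nn_integral_lborel_prod[where f = "\<lambda>b w. ennreal (normal_density (x \<bullet> b) (sqrt (2 * s)) w)"]
  by (simp add: heat_kernel_eq_prod prod_ennreal[symmetric] nn_integral_normal_density)

text \<open>Kernel and indicator both factor over the coordinates, so Tonelli applies.\<close>

lemma nn_integral_heat_kernel_cbox:
  fixes x l u :: "'a::euclidean_space"
  assumes "0 < s"
  shows "(\<integral>\<^sup>+z. ennreal (heat_kernel s x z) * indicator (cbox l u) z \<partial>lborel)
    = (\<Prod>b\<in>Basis. \<integral>\<^sup>+w. ennreal (normal_density (x \<bullet> b) (sqrt (2 * s)) w)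
        * indicator {l \<bullet> b..u \<bullet> b} w \<partial>lborel)"
proof -
  have "ennreal (heat_kernel s x z) * indicator (cbox l u) z
    = (\<Prod>b\<in>Basis. ennreal (normal_density (x \<bullet> b) (sqrt (2 * s)) (z \<bullet> b))
        * indicator {l \<bullet> b..u \<bullet> b} (z \<bullet> b))" for z
  proof -
    have "indicator (cbox l u) z = (\<Prod>b\<in>Basis. indicator {l \<bullet> b..u \<bullet> b} (z \<bullet> b) :: ennreal)"
      by (auto simp: cbox_def indicator_def prod_zero_iff)
    then show ?thesis
      using assms by (simp add: heat_kernel_eq_prod prod_ennreal[symmetric] prod.distrib)
  qed
  then show ?thesis
    using nn_integral_lborel_prod[where f = "\<lambda>b w. ennreal (normal_density (x \<bullet> b) (sqrt (2 * s)) w)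
        * indicator {l \<bullet> b..u \<bullet> b} w"]
    by simp
qed

text \<open>Numbered components make it possible to treat the long direction of a box apart from the
  two short ones.\<close>

lemma nn_integral_heat_kernel_cbox_vec:
  fixes x l u :: "real ^ 'n"
  assumes "0 < s"
  shows "(\<integral>\<^sup>+z. ennreal (heat_kernel s x z) * indicator (cbox l u) z \<partial>lborel)
    = (\<Prod>i\<in>UNIV. \<integral>\<^sup>+w. ennreal (normal_density (x $ i) (sqrt (2 * s)) w)
        * indicator {l $ i..u $ i} w \<partial>lborel)"
proof -
  have inj: "inj (\<lambda>i::'n. axis i (1::real))"
    by (auto simp: inj_on_def axis_eq_axis)
  have basis: "(Basis :: (real ^ 'n) set) = range (\<lambda>i. axis i 1)"
    by (auto simp: Basis_vec_def)
  show ?thesis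
    unfolding nn_integral_heat_kernel_cbox[OF assms] basis prod.reindex[OF inj]
    by (simp add: inner_axis)
qed

section \<open>Time-integrated Gaussian averages of a potential\<close>

text \<open>
  With \<open>\<tau> s = s\<close> and constant \<open>m\<close> this is the integral in the Kato condition; with
  \<open>\<tau> s = s (t - s) / t\<close> and \<open>m s = x + (s / t) (y - x)\<close> it is \<open>S\<close>. Potentials have values in \<open>ennreal\<close>
  because a sum of infinitely many of them may be infinite on a null set.
\<close>

definition occupation ::
    "(real \<Rightarrow> real) \<Rightarrow> (real \<Rightarrow> 'a::euclidean_space) \<Rightarrow> real \<Rightarrow> ('a \<Rightarrow> ennreal) \<Rightarrow> ennreal" where
  "occupation \<tau> m t U =
     (\<integral>\<^sup>+ s \<in> {0<..<t}. (\<integral>\<^sup>+ z. ennreal (heat_kernel (\<tau> s) (m s) z) * U z \<partial>lborel) \<partial>lborel)"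

text \<open>The almost-everywhere form serves to replace an infinite sum by a real-valued function
  that may differ from it on a null set.\<close>

lemma occupation_mono:
  "(AE z in lborel. U z \<le> U' z) \<Longrightarrow> occupation \<tau> m t U \<le> occupation \<tau> m t U'"
  unfolding occupation_def
  by (intro nn_integral_mono mult_right_mono nn_integral_mono_AE)
     (auto elim!: AE_mp intro!: mult_left_mono)

lemma occupation_sum:
  assumes [measurable]: "\<tau> \<in> borel_measurable borel" "m \<in> borel_measurable borel"
    "\<And>k. U k \<in> borel_measurable borel"
  shows "occupation \<tau> m t (\<lambda>z. \<Sum>k\<in>K. c k * U k z) = (\<Sum>k\<in>K. c k * occupation \<tau> m t (U k))"
  unfolding occupation_def
  by (simp add: sum_distrib_left sum_distrib_right nn_integral_sum mult.left_commute[of _ "c _"]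
      mult.assoc nn_integral_cmult)

lemma occupation_suminf:
  assumes [measurable]: "\<tau> \<in> borel_measurable borel" "m \<in> borel_measurable borel"
    "\<And>n. U n \<in> borel_measurable borel"
  shows "occupation \<tau> m t (\<lambda>z. \<Sum>n. U n z) = (\<Sum>n. occupation \<tau> m t (U n))"
proof -
  let ?I = "\<lambda>n s. \<integral>\<^sup>+ z. ennreal (heat_kernel (\<tau> s) (m s) z) * U n z \<partial>lborel"
  have "occupation \<tau> m t (\<lambda>z. \<Sum>n. U n z) = (\<integral>\<^sup>+ s. (\<Sum>n. ?I n s) * indicator {0<..<t} s \<partial>lborel)"
    unfolding occupation_def ennreal_suminf_cmult[symmetric] by (subst nn_integral_suminf) auto
  also have "\<dots> = (\<integral>\<^sup>+ s. (\<Sum>n. ?I n s * indicator {0<..<t} s) \<partial>lborel)"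
    unfolding ennreal_suminf_multc ..
  also have "\<dots> = (\<Sum>n. occupation \<tau> m t (U n))"
    unfolding occupation_def by (subst nn_integral_suminf) auto
  finally show ?thesis .
qed

lemma occupation_le:
  assumes "\<And>s. s \<in> {0<..<t} \<Longrightarrow> (\<integral>\<^sup>+ z. ennreal (heat_kernel (\<tau> s) (m s) z) * U z \<partial>lborel) \<le> M" "0 \<le> t"
  shows "occupation \<tau> m t U \<le> M * ennreal t"
proof -
  have "occupation \<tau> m t U \<le> (\<integral>\<^sup>+ s. M * indicator {0<..<t} s \<partial>lborel)"
    unfolding occupation_def by (intro nn_integral_mono) (use assms in \<open>auto simp: indicator_def\<close>)
  also have "\<dots> = M * ennreal t"
    using assms by (simp add: nn_integral_cmult_indicator)
  finally show ?thesis .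
qed

text \<open>The kernel has mass 1, so the potential contributes at most \<open>M\<close> per unit of
  time. Hence the Kato integral of a single bounded potential vanishes as \<open>t\<close> tends to
  0.\<close>

lemma occupation_bounded:
  assumes "\<And>s. 0 < s \<Longrightarrow> 0 < \<tau> s" "\<And>z. U z \<le> M" "0 \<le> t"
  shows "occupation \<tau> m t U \<le> M * ennreal t"
proof (rule occupation_le)
  fix s assume "s \<in> {0<..<t}"
  then have "0 < \<tau> s"
    using assms by simp
  have "(\<integral>\<^sup>+ z. ennreal (heat_kernel (\<tau> s) (m s) z) * U z \<partial>lborel)
      \<le> (\<integral>\<^sup>+ z. ennreal (heat_kernel (\<tau> s) (m s) z) * M \<partial>lborel)"
    using assms by (intro nn_integral_mono mult_left_mono) auto
  also have "\<dots> = M"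
    using \<open>0 < \<tau> s\<close> by (simp add: nn_integral_multc nn_integral_heat_kernel)
  finally show "(\<integral>\<^sup>+ z. ennreal (heat_kernel (\<tau> s) (m s) z) * U z \<partial>lborel) \<le> M" .
qed fact

lemma kato_class_iff_occupation:
  "kato_class V \<longleftrightarrow>
     ((\<lambda>t. SUP x. occupation (\<lambda>s. s) (\<lambda>s. x) t (\<lambda>z. ennreal \<bar>V z\<bar>)) \<longlongrightarrow> 0) (at_right 0)"
  by (simp add: kato_class_def occupation_def ennreal_mult)

lemma S_fun_eq_occupation:
  "S_fun V t x y = occupation (\<lambda>s. s * (t - s) / t) (\<lambda>s. x + (s / t) *\<^sub>R (y - x)) t (\<lambda>z. ennreal \<bar>V z\<bar>)"
  unfolding S_fun_def occupation_def
  by (intro nn_integral_cong)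
     (auto simp: heat_kernel_bridge ennreal_mult indicator_def simp del: times_divide_eq_left)

lemma S_norm_ge: "S_fun V t x y \<le> S_norm V t"
  unfolding S_norm_def by (rule SUP_upper2[of "(x, y)"]) auto

section \<open>Estimates for a single box in three dimensions\<close>

lemma prod_UNIV_3: "prod f (UNIV :: 3 set) = f 1 * (f 2 * f 3)"
  unfolding UNIV_3 by simp

text \<open>Up to time \<open>q\<close> the mass is at most 1. Later each thin direction gives a
  factor of order \<open>sqrt (q / s)\<close>, and integrating \<open>2 * q / s\<close> produces the
  logarithm. The long direction is estimated by 1, so the length of the box does not enter.\<close>

lemma occupation_thin_box:
  fixes l u x :: "real ^ 3"
  assumes "0 < q" "q \<le> 1" "u $ 2 - l $ 2 = 4 * sqrt q" "u $ 3 - l $ 3 = 4 * sqrt q"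
  shows "occupation (\<lambda>s. s) (\<lambda>s. x) 1 (indicator (cbox l u)) \<le> ennreal (q * (1 + 2 * ln (1 / q)))"
proof -
  let ?J = "\<lambda>s. \<integral>\<^sup>+ z. ennreal (heat_kernel s x z) * indicator (cbox l u) z \<partial>lborel"
  let ?I = "\<lambda>s i. \<integral>\<^sup>+w. ennreal (normal_density (x $ i) (sqrt (2 * s)) w) * indicator {l $ i..u $ i} w \<partial>lborel"
  have J1: "?J s \<le> 1" if "0 < s" for s
  proof -
    have "?J s \<le> (\<integral>\<^sup>+ z. ennreal (heat_kernel s x z) \<partial>lborel)"
      by (intro nn_integral_mono) (auto simp: indicator_def)
    then show ?thesis
      using that by (simp add: nn_integral_heat_kernel)
  qed
  have J2: "?J s \<le> ennreal (2 * q / s)" if "0 < s" for s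
  proof -
    have le: "?I s i \<le> ennreal (4 * sqrt q / sqrt (4 * pi * s))" if "i = 2 \<or> i = 3" for i
    proof -
      have "u $ i - l $ i = 4 * sqrt q"
        using assms that by auto
      moreover from this have "l $ i \<le> u $ i"
        using assms by (smt (verit) real_sqrt_ge_zero)
      ultimately show ?thesis
        using nn_integral_normal_density_Icc_le[OF \<open>0 < s\<close>, of "l $ i" "u $ i" "x $ i"] by simp
    qed
    have "?J s = ?I s 1 * (?I s 2 * ?I s 3)"
      by (simp only: nn_integral_heat_kernel_cbox_vec[OF that] prod_UNIV_3)
    also have "\<dots> \<le> 1 * (ennreal (4 * sqrt q / sqrt (4 * pi * s)) * ennreal (4 * sqrt q / sqrt (4 * pi * s)))"
      using that by (intro mult_mono le nn_integral_normal_density_le_1) auto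
    also have "\<dots> = ennreal (4 * q / (pi * s))"
      using that assms by (simp add: divide_simps flip: ennreal_mult)
    also have "\<dots> \<le> ennreal (2 * q / s)"
      using that assms pi_ge_two by (intro ennreal_leI) (simp add: field_simps)
    finally show ?thesis .
  qed
  have "occupation (\<lambda>s. s) (\<lambda>s. x) 1 (indicator (cbox l u))
      \<le> (\<integral>\<^sup>+ s. indicator {0..q} s + ennreal (2 * q / s) * indicator {q..1} s \<partial>lborel)"
    unfolding occupation_def
  proof (intro nn_integral_mono)
    fix s :: real
    show "?J s * indicator {0<..<1} s \<le> indicator {0..q} s + ennreal (2 * q / s) * indicator {q..1} s"
    proof (cases "s \<in> {0<..<1}")
      case True
      then show ?thesis
        using J1[of s] J2[of s] by (cases "s \<le> q") (auto simp: add_increasing2)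
    qed simp
  qed
  also have "\<dots> = ennreal q + (\<integral>\<^sup>+ s. ennreal (2 * q / s) * indicator {q..1} s \<partial>lborel)"
    using assms by (subst nn_integral_add) auto
  also have "(\<integral>\<^sup>+ s. ennreal (2 * q / s) * indicator {q..1} s \<partial>lborel) = ennreal (2 * q * ln 1 - 2 * q * ln q)"
    using assms by (intro nn_integral_FTC_Icc) (auto intro!: derivative_eq_intros)
  also have "ennreal q + \<dots> = ennreal (q * (1 + 2 * ln (1 / q)))"
    using assms by (subst ennreal_plus[symmetric]) (auto simp: ln_div algebra_simps mult_nonneg_nonpos)
  finally show ?thesis .
qed

text \<open>The distance in the first coordinate alone gives the decay, at all times below 1; the
  other two factors are at most 1.\<close>

lemma occupation_far_box:
  fixes l u x :: "real ^ 3"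
  assumes "0 \<le> D" "\<And>w. w \<in> {l $ 1..u $ 1} \<Longrightarrow> D \<le> \<bar>w - x $ 1\<bar>"
  shows "occupation (\<lambda>s. s) (\<lambda>s. x) 1 (indicator (cbox l u)) \<le> ennreal (2 * exp (- D\<^sup>2 / 8))"
proof -
  let ?I = "\<lambda>s i. \<integral>\<^sup>+w. ennreal (normal_density (x $ i) (sqrt (2 * s)) w) * indicator {l $ i..u $ i} w \<partial>lborel"
  have "occupation (\<lambda>s. s) (\<lambda>s. x) 1 (indicator (cbox l u)) \<le> ennreal (2 * exp (- D\<^sup>2 / 8)) * ennreal 1"
  proof (rule occupation_le)
    fix s :: real assume s: "s \<in> {0<..<1}"
    then have "0 < s"
      by simp
    have "(\<integral>\<^sup>+ z. ennreal (heat_kernel s x z) * indicator (cbox l u) z \<partial>lborel) = ?I s 1 * (?I s 2 * ?I s 3)"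
      by (simp only: nn_integral_heat_kernel_cbox_vec[OF \<open>0 < s\<close>] prod_UNIV_3)
    also have "\<dots> \<le> ennreal (2 * exp (- D\<^sup>2 / 8)) * (1 * 1)"
      using s assms
      by (intro mult_mono nn_integral_normal_density_tail_le nn_integral_normal_density_le_1) auto
    finally show "(\<integral>\<^sup>+ z. ennreal (heat_kernel s x z) * indicator (cbox l u) z \<partial>lborel) \<le> ennreal (2 * exp (- D\<^sup>2 / 8))"
      by simp
  qed simp
  then show ?thesis
    by simp
qed

text \<open>During \<open>{q..2 * q}\<close> the bridge mean runs along the first axis from
  \<open>q * v\<close> to \<open>2 * q * v\<close>. The box surrounds this segment with enough
  margin for each coordinate to keep a fixed mass; the time window has length
  \<open>q\<close>.\<close>

lemma occupation_bridge_box: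
  fixes l u :: "real ^ 3"
  assumes q: "0 < q" "2 * q \<le> 1" "2 * q < t"
    and box: "l $ 1 \<le> q * v - 1" "2 * q * v + 1 \<le> u $ 1" "0 \<le> v"
      "\<And>i. i \<noteq> 1 \<Longrightarrow> l $ i \<le> - 2 * sqrt q" "\<And>i. i \<noteq> 1 \<Longrightarrow> 2 * sqrt q \<le> u $ i"
  shows "ennreal ((exp (-1/4) / sqrt pi) ^ 3 * q)
    \<le> occupation (\<lambda>s. s * (t - s) / t) (\<lambda>s. (s / t) *\<^sub>R axis 1 (t * v)) t (indicator (cbox l u))"
proof -
  define c :: real where "c = exp (-1/4) / sqrt pi"
  have "0 \<le> c"
    by (simp add: c_def)
  have *: "ennreal (c ^ 3) \<le> (\<integral>\<^sup>+ z. ennreal (heat_kernel (s * (t - s) / t) ((s / t) *\<^sub>R axis 1 (t * v)) z)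
      * indicator (cbox l u) z \<partial>lborel)" if s: "s \<in> {q..2 * q}" for s
  proof -
    have "0 < s" "s < t" "0 < t"
      using s q by auto
    define \<sigma> where "\<sigma> = s * (t - s) / t"
    have \<sigma>: "0 < \<sigma>" "\<sigma> \<le> s"
      using \<open>0 < s\<close> \<open>s < t\<close> by (auto simp: \<sigma>_def field_simps)
    \<comment> \<open>The generous \<open>4 * q\<close> has the transverse margin
      \<open>2 * sqrt q\<close> as its root; the bound 1 serves the margin in the first
      direction.\<close>
    then have "\<sigma> \<le> 4 * q" "\<sigma> \<le> 1"
      using s q by auto
    from this[THEN real_sqrt_le_mono] have sq: "sqrt \<sigma> \<le> 2 * sqrt q" "sqrt \<sigma> \<le> 1"
      by (simp_all add: real_sqrt_mult)
    \<comment> \<open>The endpoint scales with \<open>t\<close>, so the speed \<open>v\<close> is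
      the same for every \<open>t\<close>.\<close>
    have m: "(s / t) *\<^sub>R axis 1 (t * v) = (axis 1 (s * v) :: real ^ 3)"
      using \<open>0 < t\<close> by (simp add: vec_eq_iff axis_def)
    have sv: "q * v \<le> s * v" "s * v \<le> 2 * q * v"
      by (rule mult_right_mono; use s box(3) in simp)+
    have coord: "ennreal c \<le> (\<integral>\<^sup>+w. ennreal (normal_density ((axis 1 (s * v) :: real ^ 3) $ i) (sqrt (2 * \<sigma>)) w)
        * indicator {l $ i..u $ i} w \<partial>lborel)" for i
    proof -
      have "l $ i \<le> (axis 1 (s * v) :: real ^ 3) $ i - sqrt \<sigma> \<and>
        (axis 1 (s * v) :: real ^ 3) $ i + sqrt \<sigma> \<le> u $ i"
      proof (cases "i = 1")
        case True
        then have "(axis 1 (s * v) :: real ^ 3) $ i = s * v"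
          by simp
        then show ?thesis
          using sq sv box(1,2) unfolding True by linarith
      next
        case False
        then have "(axis 1 (s * v) :: real ^ 3) $ i = 0"
          by (simp add: axis_def)
        then show ?thesis
          using sq box(4,5)[OF False] by linarith
      qed
      then show ?thesis
        unfolding c_def by (intro nn_integral_normal_density_Icc_ge[OF \<sigma>(1)]) auto
    qed
    have "ennreal c * (ennreal c * ennreal c) \<le> (\<integral>\<^sup>+ z. ennreal (heat_kernel \<sigma> (axis 1 (s * v)) z)
      * indicator (cbox l u) z \<partial>lborel)"
      unfolding nn_integral_heat_kernel_cbox_vec[OF \<open>0 < \<sigma>\<close>] prod_UNIV_3
      by (intro mult_mono coord) auto
    then show ?thesis
      using \<open>0 \<le> c\<close> unfolding m \<sigma>_def[symmetric] by (simp add: ennreal_mult power3_eq_cube mult.assoc)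
  qed
  have "ennreal (c ^ 3 * q) = (\<integral>\<^sup>+ s. ennreal (c ^ 3) * indicator {q..2 * q} s \<partial>lborel)"
    using q \<open>0 \<le> c\<close> by (simp add: nn_integral_cmult_indicator ennreal_mult)
  also have "\<dots> \<le> occupation (\<lambda>s. s * (t - s) / t) (\<lambda>s. (s / t) *\<^sub>R axis 1 (t * v)) t (indicator (cbox l u))"
    unfolding occupation_def using * q by (intro nn_integral_mono) (auto simp: indicator_def)
  finally show ?thesis
    by (simp add: c_def)
qed


section \<open>Bounded potentials with small Kato integral and large bridge integral\<close>

lemma harmonic_tail_unbounded: "\<exists>N. B \<le> (\<Sum>k = m..<N. 1 / (real k + 1))"
proof (rule ccontr)
  assume "\<nexists>N. B \<le> (\<Sum>k = m..<N. 1 / (real k + 1))"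
  then have less: "(\<Sum>k = m..<N. 1 / (real k + 1)) < B" for N
    by (auto simp: not_le)
  have "(\<Sum>k<n. 1 / (real (k + m) + 1)) < B" for n
    using less[of "n + m"] sum.shift_bounds_nat_ivl[of "\<lambda>k. 1 / (real k + 1)" 0 m n]
    by (simp add: atLeast0LessThan)
  then have "summable (\<lambda>k. 1 / (real (k + m) + 1))"
    by (intro summableI_nonneg_bounded[of _ B]) (auto intro: less_imp_le)
  then have "summable (\<lambda>k. inverse (real (k + (m + 1))))"
    by (simp add: inverse_eq_divide add_ac)
  then have "summable (\<lambda>k. inverse (real k))"
    by (subst (asm) summable_iff_shift)
  then show False
    using not_summable_harmonic[where 'a = real] by simp
qed

text \<open>The building block of the final sum. Scales and speed depend only on
  \<open>\<delta>\<close>, \<open>T\<close> and \<open>R\<close>, and only the endpoint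
  \<open>y\<close> varies with \<open>t\<close>, so one potential serves all
  \<open>t \<ge> T\<close>. The bound \<open>M\<close> is for the limit of small times.\<close>

lemma thin_boxes:
  fixes \<delta> T R :: real
  assumes "0 < \<delta>" "0 < T"
  obtains W :: "real ^ 3 \<Rightarrow> ennreal" and M :: real where
    "W \<in> borel_measurable borel" "0 \<le> M" "\<And>z. W z \<le> ennreal M"
    "\<And>x. occupation (\<lambda>s. s) (\<lambda>s. x) 1 W \<le> ennreal \<delta>"
    "\<And>t. T \<le> t \<Longrightarrow> \<exists>y. ennreal R \<le> occupation (\<lambda>s. s * (t - s) / t) (\<lambda>s. (s / t) *\<^sub>R y) t W"
proof -
  define q :: "nat \<Rightarrow> real" where "q k = (1/4) ^ k" for k
  have q: "0 < q k" "q k \<le> 1" for k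
    by (auto simp: q_def power_le_one)
  have q_mono: "q k \<le> q j" if "j \<le> k" for j k
    using that by (auto simp: q_def intro: power_decreasing)
  have q_Suc: "q (Suc k) = q k / 4" for k
    by (simp add: q_def)
  obtain m' where "(1/4::real) ^ m' < T / 2"
    using real_arch_pow_inv[of "T / 2" "1/4"] assms by auto
  \<comment> \<open>The extra step forces \<open>k \<ge> 1\<close>, hence
    \<open>q k \<le> 1 / 4\<close>, besides \<open>2 * q k < T\<close>.\<close>
  define m where "m = Suc m'"
  have qm: "2 * q k < T" "2 * q k \<le> 1" if "m \<le> k" for k
  proof -
    have "q k \<le> q m'" "q k \<le> q 1"
      using that by (auto intro!: q_mono simp: m_def)
    moreover have "q m' < T / 2" "q 1 = 1 / 4"
      using \<open>(1/4) ^ m' < T / 2\<close> by (auto simp: q_def)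
    ultimately show "2 * q k < T" "2 * q k \<le> 1"
      by auto
  qed
  define \<kappa> :: real where "\<kappa> = (exp (-1/4) / sqrt pi) ^ 3"
  have "0 < \<kappa>"
    by (simp add: \<kappa>_def)
  \<comment> \<open>The logarithmic factor of a thin box will be at most
    \<open>6 * (real k + 1)\<close>; the constant 12 turns the product into
    \<open>\<delta> / 2\<close>.\<close>
  define c where "c k = \<delta> / (12 * (real k + 1))" for k :: nat
  define h where "h k = c k / q k" for k
  have c: "0 < c k" and h: "0 < h k" for k
    using assms q by (auto simp: c_def h_def)
  obtain N where N: "12 * R / (\<delta> * \<kappa>) \<le> (\<Sum>k = m..<N. 1 / (real k + 1))"
    using harmonic_tail_unbounded by blast
  have "(\<Sum>k = m..<N. \<kappa> * c k) = \<delta> * \<kappa> / 12 * (\<Sum>k = m..<N. 1 / (real k + 1))"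
    by (simp add: c_def sum_distrib_left mult_ac)
  with N have N: "R \<le> (\<Sum>k = m..<N. \<kappa> * c k)"
    using \<open>0 < \<kappa>\<close> \<open>0 < \<delta>\<close> by (simp add: field_simps)
  define H where "H = (\<Sum>k = m..<N. h k)"
  have "0 \<le> H"
    using h by (simp add: H_def sum_nonneg less_imp_le)
  \<comment> \<open>Makes \<open>exp (- D\<^sup>2 / 8)\<close> equal to
    \<open>1 / (1 + 4 * H / \<delta>)\<close>, so that all distant boxes together cost at most
    \<open>\<delta> / 2\<close>. The summand 1 keeps the logarithm nonnegative.\<close>
  define D where "D = sqrt (8 * ln (1 + 4 * H / \<delta>))"
  have "0 \<le> D"
    using \<open>0 \<le> H\<close> \<open>0 < \<delta>\<close> by (simp add: D_def)
  have D: "H * (2 * exp (- D\<^sup>2 / 8)) \<le> \<delta> / 2"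
  proof -
    have "0 < 1 + 4 * H / \<delta>"
      using \<open>0 \<le> H\<close> \<open>0 < \<delta>\<close> by (simp add: add_pos_nonneg)
    moreover have "D\<^sup>2 = 8 * ln (1 + 4 * H / \<delta>)"
      using \<open>0 \<le> H\<close> \<open>0 < \<delta>\<close> by (simp add: D_def)
    ultimately have eq: "exp (- D\<^sup>2 / 8) = 1 / (1 + 4 * H / \<delta>)"
      by (simp add: exp_minus inverse_eq_divide)
    show ?thesis
      unfolding eq using \<open>0 \<le> H\<close> \<open>0 < \<delta>\<close> by (simp add: field_simps)
  qed
  \<comment> \<open>\<open>4 ^ N\<close> offsets every \<open>q k\<close> with \<open>k < N\<close>.
    The drift length \<open>q k * v\<close> is then at least \<open>5 + 4 * D\<close>, more than
    enough for gaps above \<open>2 * D\<close> between the boxes.\<close>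
  define v where "v = 4 ^ N * (5 + 4 * D)"
  have "0 \<le> v"
    using \<open>0 \<le> D\<close> by (simp add: v_def)
  have v: "5 + 4 * D \<le> q k * v" if "k < N" for k
  proof -
    have "1 \<le> 4 ^ N * q k"
      using q_mono[of k N] that by (simp add: q_def power_one_over field_simps)
    then show ?thesis
      using \<open>0 \<le> D\<close> mult_right_mono[of 1 "4 ^ N * q k" "5 + 4 * D"] by (simp add: v_def mult_ac)
  qed
  define l u :: "nat \<Rightarrow> real ^ 3" where
    "l k = (\<chi> i. if i = 1 then q k * v - 1 else - 2 * sqrt (q k))" and
    "u k = (\<chi> i. if i = 1 then 2 * q k * v + 1 else 2 * sqrt (q k))" for k
  define W where "W z = (\<Sum>k = m..<N. ennreal (h k) * indicator (cbox (l k) (u k)) z)" for z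
  have occ_W: "occupation \<tau> p t W = (\<Sum>k = m..<N. ennreal (h k) * occupation \<tau> p t (indicator (cbox (l k) (u k))))"
    if [measurable]: "\<tau> \<in> borel_measurable borel" "p \<in> borel_measurable borel" for \<tau> p t
    unfolding W_def by (rule occupation_sum) auto
  show thesis
  proof (rule that)
    show "W \<in> borel_measurable borel"
      unfolding W_def by measurable
    show "0 \<le> H" by fact
    show "W z \<le> ennreal H" for z
    proof -
      have "W z \<le> (\<Sum>k = m..<N. ennreal (h k) * 1)"
        unfolding W_def by (intro sum_mono mult_left_mono) (auto simp: indicator_def)
      then show ?thesis
        using h by (simp add: H_def less_imp_le)
    qed
    show "occupation (\<lambda>s. s) (\<lambda>s. x) 1 W \<le> ennreal \<delta>" for x
    proof -
      define near where "near k \<longleftrightarrow> (\<exists>w\<in>{l k $ 1..u k $ 1}. \<bar>w - x $ 1\<bar> < D)" for k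
      \<comment> \<open>Box \<open>j\<close> starts no earlier than \<open>4 * q k * v - 1\<close>
        and box \<open>k\<close> ends at \<open>2 * q k * v + 1\<close>. A point near both would
        force \<open>q k * v < 1 + D\<close>.\<close>
      have far: "\<not> near k" if "near j" "j < k" "k < N" for j k
      proof
        assume "near k"
        then have "x $ 1 < 2 * q k * v + 1 + D"
          by (auto simp: near_def u_def)
        moreover have "q j * v - 1 - D < x $ 1"
          using \<open>near j\<close> by (auto simp: near_def l_def)
        moreover have "4 * (q k * v) \<le> q j * v"
          using q_mono[of "Suc j" k] \<open>j < k\<close> \<open>0 \<le> v\<close> mult_right_mono[of "4 * q k" "q j" v]
          by (simp add: q_Suc)
        ultimately show False
          using v[OF \<open>k < N\<close>] \<open>0 \<le> D\<close> by simp
      qed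
      \<comment> \<open>The tail term is charged to near boxes as well, so that the sum over
        \<open>k\<close> splits into two simple sums.\<close>
      have summand: "ennreal (h k) * occupation (\<lambda>s. s) (\<lambda>s. x) 1 (indicator (cbox (l k) (u k)))
          \<le> ennreal ((if near k then \<delta> / 2 else 0) + h k * (2 * exp (- D\<^sup>2 / 8)))" for k
      proof (cases "near k")
        case True
        \<comment> \<open>This crude bound gives
          \<open>1 + 2 * ln (1 / q k) \<le> 1 + 6 * k\<close>.\<close>
        have "ln (4::real) \<le> 3"
          using ln_le_minus_one[of 4] by simp
        from mult_left_mono[OF this, of "real k"] have "ln (1 / q k) \<le> 3 * k"
          by (simp add: q_def power_one_over ln_realpow)
        then have "c k * (1 + 2 * ln (1 / q k)) \<le> c k * (6 * (real k + 1))"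
          using c[of k] by (intro mult_left_mono) auto
        also have "\<dots> = \<delta> / 2"
          by (simp add: c_def divide_simps)
        finally have "h k * (q k * (1 + 2 * ln (1 / q k))) \<le> \<delta> / 2"
          using q[of k] by (simp add: h_def)
        moreover have "0 \<le> ln (1 / q k)"
          using q[of k] by simp
        moreover have "ennreal (h k) * occupation (\<lambda>s. s) (\<lambda>s. x) 1 (indicator (cbox (l k) (u k)))
            \<le> ennreal (h k) * ennreal (q k * (1 + 2 * ln (1 / q k)))"
          using q[of k] by (intro mult_left_mono occupation_thin_box) (auto simp: l_def u_def)
        ultimately show ?thesis
          using True h[of k] q[of k]
          by (auto simp flip: ennreal_mult elim!: order_trans intro!: ennreal_leI add_increasing2)
      next
        case False
        then have "ennreal (h k) * occupation (\<lambda>s. s) (\<lambda>s. x) 1 (indicator (cbox (l k) (u k)))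
            \<le> ennreal (h k) * ennreal (2 * exp (- D\<^sup>2 / 8))"
          using \<open>0 \<le> D\<close> by (intro mult_left_mono occupation_far_box) (auto simp: near_def not_less)
        then show ?thesis
          using False h[of k] by (simp add: ennreal_mult)
      qed
      let ?K = "{k \<in> {m..<N}. near k}"
      \<comment> \<open>By the separation, \<open>\<delta> / 2\<close> is charged at most
        once.\<close>
      have "card ?K \<le> 1"
        using far by (simp add: card_le_Suc0_iff_eq) (metis linorder_less_linear)
      then have near: "(\<Sum>k = m..<N. if near k then \<delta> / 2 else 0) \<le> \<delta> / 2"
        using \<open>0 < \<delta>\<close> by (simp add: sum.If_cases Int_def)
      have "occupation (\<lambda>s. s) (\<lambda>s. x) 1 W
          \<le> (\<Sum>k = m..<N. ennreal ((if near k then \<delta> / 2 else 0) + h k * (2 * exp (- D\<^sup>2 / 8))))"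
        by (subst occ_W, simp, simp, intro sum_mono summand)
      also have "\<dots> = ennreal ((\<Sum>k = m..<N. if near k then \<delta> / 2 else 0) + H * (2 * exp (- D\<^sup>2 / 8)))"
        using \<open>0 < \<delta>\<close> h
        by (subst sum_ennreal) (auto simp: sum.distrib H_def sum_distrib_right less_imp_le)
      also have "\<dots> \<le> ennreal \<delta>"
        using near D by (intro ennreal_leI) simp
      finally show ?thesis .
    qed
    show "\<exists>y. ennreal R \<le> occupation (\<lambda>s. s * (t - s) / t) (\<lambda>s. (s / t) *\<^sub>R y) t W"
      if "T \<le> t" for t
    proof
      have "ennreal R \<le> (\<Sum>k = m..<N. ennreal (\<kappa> * c k))"
        using N \<open>0 < \<kappa>\<close> c by (subst sum_ennreal) (auto intro: ennreal_leI less_imp_le)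
      also have "\<dots> \<le> (\<Sum>k = m..<N. ennreal (h k) *
          occupation (\<lambda>s. s * (t - s) / t) (\<lambda>s. (s / t) *\<^sub>R axis 1 (t * v)) t (indicator (cbox (l k) (u k))))"
      proof (rule sum_mono)
        fix k assume k: "k \<in> {m..<N}"
        \<comment> \<open>The height \<open>h k\<close> cancels the length \<open>q k\<close> of the
          time window and leaves \<open>c k\<close>.\<close>
        have "ennreal (\<kappa> * c k) = ennreal (h k) * ennreal (\<kappa> * q k)"
          using h[of k] q[of k] \<open>0 < \<kappa>\<close> by (simp add: h_def mult.commute flip: ennreal_mult)
        also have "\<dots> \<le> ennreal (h k) *
          occupation (\<lambda>s. s * (t - s) / t) (\<lambda>s. (s / t) *\<^sub>R axis 1 (t * v)) t (indicator (cbox (l k) (u k)))"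
          unfolding \<kappa>_def
          using k qm[of k] q[of k] that \<open>0 \<le> v\<close>
          by (intro mult_left_mono occupation_bridge_box) (auto simp: l_def u_def)
        finally show "ennreal (\<kappa> * c k) \<le> ennreal (h k) *
          occupation (\<lambda>s. s * (t - s) / t) (\<lambda>s. (s / t) *\<^sub>R axis 1 (t * v)) t (indicator (cbox (l k) (u k)))" .
      qed
      also have "\<dots> = occupation (\<lambda>s. s * (t - s) / t) (\<lambda>s. (s / t) *\<^sub>R axis 1 (t * v)) t W"
        by (rule occ_W[symmetric]) auto
      finally show "ennreal R \<le> occupation (\<lambda>s. s * (t - s) / t) (\<lambda>s. (s / t) *\<^sub>R axis 1 (t * v)) t W" .
    qed
  qed
qed


section \<open>Superposition of the bounded potentials\<close>

lemma occupation_mono_time: "t \<le> t' \<Longrightarrow> occupation \<tau> m t U \<le> occupation \<tau> m t' U"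
  unfolding occupation_def by (intro nn_integral_mono mult_left_mono) (auto simp: indicator_def)

text \<open>The space integral is finite at some positive time, and the kernel at that time is
  strictly positive everywhere.\<close>

lemma occupation_finite_imp_AE_finite:
  fixes U :: "'a::euclidean_space \<Rightarrow> ennreal"
  assumes [measurable]: "U \<in> borel_measurable borel" and "occupation (\<lambda>s. s) (\<lambda>s. x) 1 U \<noteq> \<infinity>"
  shows "AE z in lborel. U z \<noteq> \<infinity>"
proof -
  let ?J = "\<lambda>s. \<integral>\<^sup>+ z. ennreal (heat_kernel s x z) * U z \<partial>lborel"
  have "\<exists>s\<in>{0<..<1}. ?J s \<noteq> \<infinity>"
  proof (rule ccontr)
    assume "\<not> (\<exists>s\<in>{0<..<1}. ?J s \<noteq> \<infinity>)"
    then have "occupation (\<lambda>s. s) (\<lambda>s. x) 1 U = (\<integral>\<^sup>+ s. \<infinity> * indicator {0<..<1::real} s \<partial>lborel)"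
      unfolding occupation_def by (intro nn_integral_cong) (auto simp: indicator_def)
    also have "\<dots> = \<infinity>"
      by (subst nn_integral_cmult_indicator) auto
    finally show False
      using assms by simp
  qed
  then obtain s where s: "0 < s" "?J s \<noteq> \<infinity>"
    by auto
  then have "AE z in lborel. ennreal (heat_kernel s x z) * U z \<noteq> \<infinity>"
    by (intro nn_integral_noteq_infinite) auto
  then show ?thesis
  proof eventually_elim
    case (elim z)
    then show ?case
      using heat_kernel_pos[OF \<open>0 < s\<close>, of x z] by (auto simp: ennreal_mult_eq_top_iff)
  qed
qed

theorem theorem1p5:
  shows "\<exists>V :: real^3 \<Rightarrow> real. V \<in> borel_measurable borel \<and> (\<forall>z. V z \<le> 0) \<and>
           kato_class V \<and> (\<forall>t>0. S_norm V t = \<infinity>)"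
proof -
  \<comment> \<open>The Kato bounds are summable, the time thresholds tend to 0 and the bridge
    bounds are unbounded. \<open>Suc n\<close> keeps the threshold positive at
    \<open>n = 0\<close>.\<close>
  define P :: "nat \<Rightarrow> (real ^ 3 \<Rightarrow> ennreal) \<Rightarrow> real \<Rightarrow> bool" where
    "P n W M \<longleftrightarrow> W \<in> borel_measurable borel \<and> 0 \<le> M \<and> (\<forall>z. W z \<le> ennreal M) \<and>
      (\<forall>x. occupation (\<lambda>s. s) (\<lambda>s. x) 1 W \<le> ennreal ((1/2) ^ n)) \<and>
      (\<forall>t\<ge>1 / real (Suc n). \<exists>y. ennreal (real n) \<le>
        occupation (\<lambda>s. s * (t - s) / t) (\<lambda>s. (s / t) *\<^sub>R y) t W)" for n W M
  have "\<exists>W M. P n W M" for n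
    unfolding P_def by (rule thin_boxes[of "(1/2) ^ n" "1 / real (Suc n)" "real n"]) (simp, simp, blast)
  then obtain W M where P: "\<And>n. P n (W n) (M n)"
    by metis
  have W [measurable]: "W n \<in> borel_measurable borel"
    and M: "0 \<le> M n" "W n z \<le> ennreal (M n)"
    and kato: "occupation (\<lambda>s. s) (\<lambda>s. x) 1 (W n) \<le> ennreal ((1/2) ^ n)" for n x z
    using P[of n] unfolding P_def by blast+
  have bridge: "\<exists>y. ennreal (real n) \<le>
      occupation (\<lambda>s. s * (t - s) / t) (\<lambda>s. (s / t) *\<^sub>R y) t (W n)"
    if "1 / real (Suc n) \<le> t" for n t
    using P[of n] that unfolding P_def by blast
  define U where "U z = (\<Sum>n. W n z)" for z
  have U [measurable]: "U \<in> borel_measurable borel"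
    unfolding U_def by measurable
  have occ_U: "occupation (\<lambda>s. s) (\<lambda>s. x) t U = (\<Sum>n. occupation (\<lambda>s. s) (\<lambda>s. x) t (W n))" for x t
    unfolding U_def by (rule occupation_suminf) auto
  \<comment> \<open>For fixed \<open>n\<close> the first bound vanishes with \<open>t\<close>; the
    second is summable and free of \<open>t\<close>. Together they permit dominated convergence of
    the series.\<close>
  define f where "f n t = min (M n * t) ((1/2) ^ n)" for n and t :: real
  have occ_U_le: "occupation (\<lambda>s. s) (\<lambda>s. x) t U \<le> ennreal (\<Sum>n. f n t)" if "0 < t" "t \<le> 1" for x t
  proof -
    have nonneg: "0 \<le> f n t" for n
      using M that by (simp add: f_def)
    have "summable (\<lambda>n. f n t)"
      by (rule summable_comparison_test'[OF summable_geometric[of "1/2"]])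
         (use nonneg in \<open>auto simp: f_def\<close>)
    have "occupation (\<lambda>s. s) (\<lambda>s. x) t (W n) \<le> ennreal (f n t)" for n
    proof -
      have "occupation (\<lambda>s. s) (\<lambda>s. x) t (W n) \<le> ennreal (M n) * ennreal t"
        using M that by (intro occupation_bounded) auto
      moreover have "occupation (\<lambda>s. s) (\<lambda>s. x) t (W n) \<le> ennreal ((1/2) ^ n)"
        using occupation_mono_time[OF \<open>t \<le> 1\<close>] kato order_trans by blast
      ultimately show ?thesis
        using M that by (simp add: f_def min_def ennreal_mult)
    qed
    then have "occupation (\<lambda>s. s) (\<lambda>s. x) t U \<le> (\<Sum>n. ennreal (f n t))"
      unfolding occ_U by (intro suminf_le) auto
    also have "\<dots> = ennreal (\<Sum>n. f n t)"
      using nonneg \<open>summable _\<close> by (rule suminf_ennreal2)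
    finally show ?thesis .
  qed
  have f_lim: "((\<lambda>t. \<Sum>n. f n t) \<longlongrightarrow> 0) (at_right 0)"
  proof -
    have "((\<lambda>t. \<Sum>n. f n t) \<longlongrightarrow> (\<Sum>n::nat. 0::real)) (at_right 0)"
    proof (rule tannerys_theorem[THEN conjunct2, THEN conjunct2])
      show "((\<lambda>t. f n t) \<longlongrightarrow> 0) (at_right 0)" for n
      proof -
        have "((\<lambda>t. min (M n * t) ((1/2) ^ n)) \<longlongrightarrow> min (M n * 0) ((1/2) ^ n)) (at_right 0)"
          by (intro tendsto_intros)
        then show ?thesis
          by (simp add: f_def)
      qed
      have "eventually (\<lambda>t::real. 0 < t) (at_right 0)"
        by (rule eventually_at_right_less)
      from eventually_prodI[OF eventually_True[of sequentially] this]
      show "eventually (\<lambda>(n, t). norm (f n t) \<le> (1/2) ^ n) (at_top \<times>\<^sub>F at_right 0)"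
        by eventually_elim (use M(1) in \<open>auto simp: f_def\<close>)
    qed (auto simp: summable_geometric)
    then show ?thesis
      by simp
  qed
  \<comment> \<open>\<open>enn2real\<close> sends infinity to 0: the absolute value of
    \<open>V\<close> is at most \<open>U\<close> everywhere and equals \<open>U\<close> wherever
    \<open>U\<close> is finite.\<close>
  define V where "V z = - enn2real (U z)" for z
  have V_le: "ennreal \<bar>V z\<bar> \<le> U z" for z
    by (cases "U z") (auto simp: V_def)
  \<comment> \<open>A finite Kato integral at one point already makes \<open>U\<close> finite almost
    everywhere.\<close>
  have "occupation (\<lambda>s. s) (\<lambda>s. 0) 1 U \<noteq> \<infinity>"
    using occ_U_le[of 1 0] by (auto simp: top_unique)
  from occupation_finite_imp_AE_finite[OF U this]
  have V_ge: "AE z in lborel. U z \<le> ennreal \<bar>V z\<bar>"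
    by eventually_elim (simp add: V_def less_top)
  have "kato_class V"
    unfolding kato_class_iff_occupation
  proof (rule tendsto_sandwich[of "\<lambda>_. 0" _ _ "\<lambda>t. ennreal (\<Sum>n. f n t)"])
    have "eventually (\<lambda>t::real. t \<in> {0<..<1}) (at_right 0)"
      by (rule eventually_at_right_real) simp
    then show "eventually (\<lambda>t. (SUP x. occupation (\<lambda>s. s) (\<lambda>s. x) t (\<lambda>z. ennreal \<bar>V z\<bar>))
        \<le> ennreal (\<Sum>n. f n t)) (at_right 0)"
    proof eventually_elim
      case (elim t)
      then show ?case
        using V_le by (intro SUP_least order_trans[OF occupation_mono occ_U_le]) auto
    qed
    show "((\<lambda>t. ennreal (\<Sum>n. f n t)) \<longlongrightarrow> 0) (at_right 0)"
      using tendsto_ennrealI[OF f_lim] by simp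
  qed auto
  moreover have "S_norm V t = \<infinity>" if "0 < t" for t
  proof (rule ccontr)
    assume "S_norm V t \<noteq> \<infinity>"
    then obtain r where r: "0 \<le> r" "S_norm V t = ennreal r"
      by (cases "S_norm V t") auto
    \<comment> \<open>\<open>1 / t\<close> brings \<open>t\<close> above the threshold of the
      \<open>n\<close>-th potential; \<open>r + 1\<close> makes its bridge integral exceed the
      supposed norm.\<close>
    obtain n where n: "max (r + 1) (1 / t) \<le> real n"
      using real_arch_simple by blast
    then have "1 / real (Suc n) \<le> t"
      using that by (simp add: field_simps)
    then obtain y where "ennreal (real n) \<le>
        occupation (\<lambda>s. s * (t - s) / t) (\<lambda>s. (s / t) *\<^sub>R y) t (W n)"
      using bridge by blast
    \<comment> \<open>The single summand \<open>W n\<close> lies below \<open>U\<close>, hence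
      almost everywhere below the absolute value of \<open>V\<close>.\<close>
    also have "\<dots> \<le> S_fun V t 0 y"
      unfolding S_fun_eq_occupation diff_zero add_0
    proof (rule occupation_mono)
      show "AE z in lborel. W n z \<le> ennreal \<bar>V z\<bar>"
        using V_ge
      proof eventually_elim
        case (elim z)
        have "W n z \<le> U z"
          unfolding U_def using sum_le_suminf[of "\<lambda>n. W n z" "{n}"] by simp
        with elim show ?case
          by (rule order_trans[rotated])
      qed
    qed
    also have "\<dots> \<le> ennreal r"
      using S_norm_ge[of V t 0 y] r by simp
    finally show False
      using n r by simp
  qed
  moreover have "V \<in> borel_measurable borel"
    unfolding V_def by measurable
  moreover have "\<forall>z. V z \<le> 0"
    by (simp add: V_def)
  ultimately show ?thesis
    by blast
qed

end
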